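(* Let $G$ be a countably infinite amenable group, and $G\curvearrowright X$ an expansive action on a compact metrizable space by homeomorphisms with the strong topological Markov property. (1) If $h_{\rm top}(G\curvearrowright X)>0$, then for every integer $k\ge2$ there exists $(x_1,\dots,x_k)\in\mathtt{A}_k(X,G)$ with $x_1,\dots,x_k$ distinct. (2) If $G\curvearrowright X$ has uniform positive entropy (UPE) of order $k$ for some $k\ge2$, then $\mathtt{A}_k(X,G)$ is dense in $X^k$.
   Context: Fix a compatible metric $d$ on $X$ (the notions below do not depend on its choice). For $K\subset G$ and $x,y\in X$ write $d_K(x,y)=\sup_{g\in K}d(gx,gy)$. Expansive: there is $c>0$ such that for all $x\neq y$ in $X$ there is $g\in G$ with $d(gx,gy)>c$. $\mathtt{A}_k(X,G)$ is the set of asymptotic $k$-tuples: $(x_1,\dots,x_k)\in X^k$ such that for every $\varepsilon>0$ there is a finite $F\subset G$ with $d(gx_i,gx_j)\le\varepsilon$ for all $g\notin F$ and $1\le i,j\le k$. Memory set: for $\varepsilon,\delta>0$ and finite $A\subset B\subset G$, $B$ is an $(\varepsilon,\delta)$-memory set for $A$ if for every $x,y\in X$ with $d_{B\setminus A}(x,y)\le\delta$ there is $z\in X$ with $d_B(x,z)\le\varepsilon$ and $d_{G\setminus A}(y,z)\le\varepsilon$. Strong topological Markov property: for every $\varepsilon>0$ there exist $\delta>0$ and a finite set $F\subset G$ containing the identity such that for every finite $A\subset G$ the set $FA$ is an $(\varepsilon,\delta)$-memory set for $A$. Topological entropy: for an open cover $\mathcal U$ and nonempty finite $F\subset G$, $N(\mathcal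 U^F)$ is the minimal cardinality of a subcover of $\mathcal U^F=\bigvee_{g\in F}g^{-1}\mathcal U$; $h_{\rm top}(G\curvearrowright X)=\sup_{\mathcal U}\lim_n\frac1{|F_n|}\log N(\mathcal U^{F_n})$, where $\{F_n\}$ is any left F\o lner sequence ($|KF_n\,\Delta\,F_n|/|F_n|\to0$ for every finite nonempty $K\subset G$). Independence: for a tuple $\mathbf A=(A_1,\dots,A_k)$ of subsets of $X$, $J\subset G$ is an independence set for $\mathbf A$ if for every nonempty finite $I\subset J$ and every $\phi:I\to\{1,\dots,k\}$ we have $\bigcap_{s\in I}s^{-1}A_{\phi(s)}\neq\varnothing$. The independence density of $\mathbf A$ is the largest $q\ge0$ such that every finite $F\subset G$ has a subset of cardinality at least $q|F|$ which is an independence set for $\mathbf A$. $\mathrm{IE}_k(X,G)$ is the set of $(x_1,\dots,x_k)\in X^k$ such that for every product neighborhood $U_1\times\dots\times U_k$ of it the tuple $(U_1,\dots,U_k)$ has positive independence density. For amenable $G$ and $k\ge2$, $G\curvearrowright X$ has UPE of order $k$ if $\mathrm{IE}_k(X,G)=X^k$. *)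

theory Defs
  imports "HOL-Analysis.Analysis" "HOL-Algebra.Group_Action" "HOL-Algebra.Coset"
begin

text \<open>
  Throughout, \<open>G\<close> is a group, \<open>X\<close> a compact subset of a metric space type (the compact metrizable
  space together with a fixed compatible metric), and \<open>\<phi> g\<close> is the action of \<open>g\<close> on \<open>X\<close>.
  A \<open>k\<close>-tuple over \<open>X\<close> is an element of \<open>{1..k} \<rightarrow>\<^sub>E X\<close>.
\<close>

definition action_by_homeos ::
  "('g, 'b) monoid_scheme \<Rightarrow> ('g \<Rightarrow> 'x \<Rightarrow> 'x) \<Rightarrow> 'x::topological_space set \<Rightarrow> bool" where
  "action_by_homeos G \<phi> X \<longleftrightarrow>
     group_action G X \<phi> \<and>
     (\<forall>g\<in>carrier G. homeomorphic_map (top_of_set X) (top_of_set X) (\<phi> g))"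

definition expansive ::
  "('g, 'b) monoid_scheme \<Rightarrow> ('g \<Rightarrow> 'x \<Rightarrow> 'x) \<Rightarrow> 'x::metric_space set \<Rightarrow> bool" where
  "expansive G \<phi> X \<longleftrightarrow>
     (\<exists>c>0. \<forall>x\<in>X. \<forall>y\<in>X. x \<noteq> y \<longrightarrow> (\<exists>g\<in>carrier G. dist (\<phi> g x) (\<phi> g y) > c))"

definition asymptotic_tuples ::
  "('g, 'b) monoid_scheme \<Rightarrow> ('g \<Rightarrow> 'x \<Rightarrow> 'x) \<Rightarrow> 'x::metric_space set \<Rightarrow> nat \<Rightarrow> (nat \<Rightarrow> 'x) set" where
  "asymptotic_tuples G \<phi> X k =
     {x \<in> {1..k} \<rightarrow>\<^sub>E X. \<forall>\<epsilon>>0. \<exists>F. finite F \<and> F \<subseteq> carrier G \<and>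
        (\<forall>g\<in>carrier G - F. \<forall>i\<in>{1..k}. \<forall>j\<in>{1..k}. dist (\<phi> g (x i)) (\<phi> g (x j)) \<le> \<epsilon>)}"

text \<open>
  The supremum of distances over \<open>K\<close>; inserting \<open>0\<close> gives the value \<open>0\<close> for \<open>K = {}\<close> and changes
  nothing otherwise.
\<close>

definition dist_on ::
  "('g \<Rightarrow> 'x \<Rightarrow> 'x) \<Rightarrow> 'g set \<Rightarrow> 'x::metric_space \<Rightarrow> 'x \<Rightarrow> real" where
  "dist_on \<phi> K x y = Sup (insert 0 ((\<lambda>g. dist (\<phi> g x) (\<phi> g y)) ` K))"

definition memory_set ::
  "('g, 'b) monoid_scheme \<Rightarrow> ('g \<Rightarrow> 'x \<Rightarrow> 'x) \<Rightarrow> 'x::metric_space set \<Rightarrow>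
     real \<Rightarrow> real \<Rightarrow> 'g set \<Rightarrow> 'g set \<Rightarrow> bool" where
  "memory_set G \<phi> X \<epsilon> \<delta> A B \<longleftrightarrow>
     finite B \<and> A \<subseteq> B \<and> B \<subseteq> carrier G \<and>
     (\<forall>x\<in>X. \<forall>y\<in>X. dist_on \<phi> (B - A) x y \<le> \<delta> \<longrightarrow>
        (\<exists>z\<in>X. dist_on \<phi> B x z \<le> \<epsilon> \<and> dist_on \<phi> (carrier G - A) y z \<le> \<epsilon>))"

definition strong_topological_Markov ::
  "('g, 'b) monoid_scheme \<Rightarrow> ('g \<Rightarrow> 'x \<Rightarrow> 'x) \<Rightarrow> 'x::metric_space set \<Rightarrow> bool" where
  "strong_topological_Markov G \<phi> X \<longleftrightarrow>
     (\<forall>\<epsilon>>0. \<exists>\<delta>>0. \<exists>F. finite F \<and> F \<subseteq> carrier G \<and> \<one>\<^bsub>G\<^esub> \<in> F \<and>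
        (\<forall>A. finite A \<and> A \<subseteq> carrier G \<longrightarrow> memory_set G \<phi> X \<epsilon> \<delta> A (F <#>\<^bsub>G\<^esub> A)))"

definition left_Folner ::
  "('g, 'b) monoid_scheme \<Rightarrow> (nat \<Rightarrow> 'g set) \<Rightarrow> bool" where
  "left_Folner G F \<longleftrightarrow>
     (\<forall>n. finite (F n) \<and> F n \<noteq> {} \<and> F n \<subseteq> carrier G) \<and>
     (\<forall>K. finite K \<and> K \<noteq> {} \<and> K \<subseteq> carrier G \<longrightarrow>
        (\<lambda>n. real (card (sym_diff (K <#>\<^bsub>G\<^esub> F n) (F n))) / real (card (F n))) \<longlonglongrightarrow> 0)"

text \<open>For countable groups, amenability is the existence of a left Folner sequence.\<close>

definition amenable :: "('g, 'b) monoid_scheme \<Rightarrow> bool" where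
  "amenable G \<longleftrightarrow> group G \<and> countable (carrier G) \<and> (\<exists>F. left_Folner G F)"

definition open_cover :: "'x::topological_space set \<Rightarrow> 'x set set \<Rightarrow> bool" where
  "open_cover X \<U> \<longleftrightarrow> (\<forall>U\<in>\<U>. openin (top_of_set X) U) \<and> \<Union>\<U> = X"

definition translate_preimage :: "('g \<Rightarrow> 'x \<Rightarrow> 'x) \<Rightarrow> 'x set \<Rightarrow> 'g \<Rightarrow> 'x set \<Rightarrow> 'x set" where
  "translate_preimage \<phi> X g U = {x \<in> X. \<phi> g x \<in> U}"

definition cover_join ::
  "('g \<Rightarrow> 'x \<Rightarrow> 'x) \<Rightarrow> 'x set \<Rightarrow> 'x set set \<Rightarrow> 'g set \<Rightarrow> 'x set set" where
  "cover_join \<phi> X \<U> F = {\<Inter>g\<in>F. translate_preimage \<phi> X g (U g) | U. U \<in> F \<rightarrow> \<U>}"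

definition min_subcover_card :: "'x set \<Rightarrow> 'x set set \<Rightarrow> nat" where
  "min_subcover_card X \<U> = (LEAST n. \<exists>\<V>\<subseteq>\<U>. finite \<V> \<and> card \<V> = n \<and> X \<subseteq> \<Union>\<V>)"

text \<open>
  Entropy computed along the Folner sequence \<open>F\<close>. By the Ornstein--Weiss lemma the limit exists
  for every open cover and does not depend on \<open>F\<close>, so the supremum below ranges over all open covers.
  The limit is expressed as a relation because the function \<open>lim\<close> is unspecified off convergent
  sequences.
\<close>

definition top_entropy ::
  "('g \<Rightarrow> 'x \<Rightarrow> 'x) \<Rightarrow> 'x::topological_space set \<Rightarrow> (nat \<Rightarrow> 'g set) \<Rightarrow> ereal" where
  "top_entropy \<phi> X F =
     Sup {ereal l | l \<U>. open_cover X \<U> \<and>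
       (\<lambda>n. ln (real (min_subcover_card X (cover_join \<phi> X \<U> (F n)))) / real (card (F n)))
         \<longlonglongrightarrow> l}"

definition independence_set ::
  "('g, 'b) monoid_scheme \<Rightarrow> ('g \<Rightarrow> 'x \<Rightarrow> 'x) \<Rightarrow> 'x set \<Rightarrow> nat \<Rightarrow> (nat \<Rightarrow> 'x set) \<Rightarrow> 'g set \<Rightarrow> bool" where
  "independence_set G \<phi> X k A J \<longleftrightarrow>
     J \<subseteq> carrier G \<and>
     (\<forall>I \<psi>. finite I \<and> I \<noteq> {} \<and> I \<subseteq> J \<and> \<psi> \<in> I \<rightarrow> {1..k} \<longrightarrow>
        (\<Inter>s\<in>I. translate_preimage \<phi> X s (A (\<psi> s))) \<noteq> {})"

definition independence_density ::
  "('g, 'b) monoid_scheme \<Rightarrow> ('g \<Rightarrow> 'x \<Rightarrow> 'x) \<Rightarrow> 'x set \<Rightarrow> nat \<Rightarrow> (nat \<Rightarrow> 'x set) \<Rightarrow> real" where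
  "independence_density G \<phi> X k A =
     (GREATEST q. q \<ge> 0 \<and> (\<forall>F. finite F \<and> F \<subseteq> carrier G \<longrightarrow>
        (\<exists>J\<subseteq>F. real (card J) \<ge> q * real (card F) \<and> independence_set G \<phi> X k A J)))"

definition IE_tuples ::
  "('g, 'b) monoid_scheme \<Rightarrow> ('g \<Rightarrow> 'x \<Rightarrow> 'x) \<Rightarrow> 'x::topological_space set \<Rightarrow> nat \<Rightarrow>
     (nat \<Rightarrow> 'x) set" where
  "IE_tuples G \<phi> X k =
     {x \<in> {1..k} \<rightarrow>\<^sub>E X. \<forall>U.
        (\<forall>i\<in>{1..k}. U i \<subseteq> X \<and> x i \<in> top_of_set X interior_of U i) \<longrightarrow>
        independence_density G \<phi> X k U > 0}"

definition UPE ::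
  "('g, 'b) monoid_scheme \<Rightarrow> ('g \<Rightarrow> 'x \<Rightarrow> 'x) \<Rightarrow> 'x::topological_space set \<Rightarrow> nat \<Rightarrow> bool" where
  "UPE G \<phi> X k \<longleftrightarrow> IE_tuples G \<phi> X k = ({1..k} \<rightarrow>\<^sub>E X)"

definition dense_in_power :: "'x::topological_space set \<Rightarrow> nat \<Rightarrow> (nat \<Rightarrow> 'x) set \<Rightarrow> bool" where
  "dense_in_power X k S \<longleftrightarrow>
     product_topology (\<lambda>i. top_of_set X) {1..k} closure_of S = ({1..k} \<rightarrow>\<^sub>E X)"

end

theory Submission
  imports Defs
begin

text \<open>
  On a Folner set \<open>A\<close> the boundary \<open>K A - A\<close> carries at most \<open>M\<^sup>b\<close> approximate orbit patterns, where
  \<open>b = o(|A|)\<close> is its cardinality. An exponentially large family of orbit patterns on \<open>A\<close> therefore contains a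
  still exponentially large subfamily with the same boundary pattern, and the Markov property
  glues the members of the subfamily to a common exterior; by expansivity the glued points are
  asymptotic. With positive entropy the family is a maximal separated set, and separated points
  stay distinct after gluing. With positive independence density the family is indexed by the
  functions \<open>J \<rightarrow> {1..k}\<close> on an independence set \<open>J \<subseteq> A\<close>; a subfamily of more than \<open>(k-1)\<^bsup>|J|\<^esup>\<close> functions takes
  all \<open>k\<close> values at some \<open>s \<in> J\<close>, and translating by \<open>s\<close> gives an asymptotic tuple close to the prescribed one.
\<close>

section \<open>Folner sequences\<close>

text \<open>Almost invariance makes the whole symmetric difference small; its outer half
  \<open>K F n - F n\<close> is the region on which the Markov property asks for agreement.\<close>

lemma left_Folner_boundary:
  assumes "left_Folner G F" "finite K" "K \<noteq> {}" "K \<subseteq> carrier G" "\<tau> > 0"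
  shows "\<forall>\<^sub>F n in sequentially. real (card ((K <#>\<^bsub>G\<^esub> F n) - F n)) \<le> \<tau> * real (card (F n))"
proof -
  have F: "finite (F n)" "F n \<noteq> {}" for n
    using assms(1) by (auto simp: left_Folner_def)
  have "(\<lambda>n. real (card (sym_diff (K <#>\<^bsub>G\<^esub> F n) (F n))) / real (card (F n))) \<longlonglongrightarrow> 0"
    using assms by (auto simp: left_Folner_def)
  then have "\<forall>\<^sub>F n in sequentially.
      real (card (sym_diff (K <#>\<^bsub>G\<^esub> F n) (F n))) / real (card (F n)) < \<tau>"
    using assms(5) by (rule order_tendstoD)
  then show ?thesis
  proof (rule eventually_mono)
    fix n
    assume less: "real (card (sym_diff (K <#>\<^bsub>G\<^esub> F n) (F n))) / real (card (F n)) < \<tau>"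
    have pos: "card (F n) > 0"
      using F by (simp add: card_gt_0_iff)
    have "finite (K <#>\<^bsub>G\<^esub> F n)"
      using assms(2) F by (simp add: set_mult_def)
    then have "card ((K <#>\<^bsub>G\<^esub> F n) - F n) \<le> card (sym_diff (K <#>\<^bsub>G\<^esub> F n) (F n))"
      using F by (intro card_mono) auto
    moreover have "real (card (sym_diff (K <#>\<^bsub>G\<^esub> F n) (F n))) < \<tau> * real (card (F n))"
      using less pos by (simp add: field_simps)
    ultimately show "real (card ((K <#>\<^bsub>G\<^esub> F n) - F n)) \<le> \<tau> * real (card (F n))"
      by linarith
  qed
qed

lemma (in group) card_set_mult_ge:
  assumes "finite K" "K \<subseteq> carrier G" "finite A" "A \<noteq> {}" "A \<subseteq> carrier G"
  shows "card K \<le> card (K <#> A)"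
proof -
  obtain a where a: "a \<in> A"
    using assms by auto
  have "card K = card ((\<lambda>k. k \<otimes> a) ` K)"
    using a assms by (subst card_image) (auto simp: inj_on_def subset_iff)
  also have "\<dots> \<le> card (K <#> A)"
    using a assms by (intro card_mono) (auto simp: set_mult_def)
  finally show ?thesis .
qed

text \<open>Almost invariance under a large \<open>K\<close> excludes small Folner sets:
  \<open>K F n\<close> has at least as many elements as \<open>K\<close>, but eventually at most
  twice as many as \<open>F n\<close>.\<close>

lemma (in group) left_Folner_card_at_top:
  assumes "left_Folner G F" "infinite (carrier G)"
  shows "filterlim (\<lambda>n. card (F n)) at_top sequentially"
  unfolding filterlim_at_top
proof
  fix N
  \<comment> \<open>With boundary constant 1 the comparison reads
    \<open>2 * N + 1 \<le> 2 * card (F n)\<close>.\<close>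
  obtain K where K: "finite K" "card K = 2 * N + 1" "K \<subseteq> carrier G"
    using assms(2) infinite_arbitrarily_large by blast
  have "K \<noteq> {}"
    using K by auto
  show "\<forall>\<^sub>F n in sequentially. N \<le> card (F n)"
    using left_Folner_boundary[OF assms(1) K(1) \<open>K \<noteq> {}\<close> K(3) zero_less_one]
  proof (rule eventually_mono)
    fix n
    assume "real (card ((K <#> F n) - F n)) \<le> 1 * real (card (F n))"
    moreover have F: "finite (F n)" "F n \<noteq> {}" "F n \<subseteq> carrier G"
      using assms(1) by (auto simp: left_Folner_def)
    then have "card K \<le> card (K <#> F n)"
      using K by (intro card_set_mult_ge)
    moreover have "card (K <#> F n) \<le> card ((K <#> F n) - F n) + card (F n)"
      using F K(1) card_mono[of "((K <#> F n) - F n) \<union> F n" "K <#> F n"]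
        card_Un_le[of "(K <#> F n) - F n" "F n"]
      by (auto simp: set_mult_def)
    ultimately show "N \<le> card (F n)"
      using K by linarith
  qed
qed

section \<open>Asymptotic tuples from the strong topological Markov property\<close>

lemma asymptotic_tuples_mem:
  assumes "x \<in> asymptotic_tuples G \<phi> X k"
  shows "x \<in> {1..k} \<rightarrow>\<^sub>E X"
  using assms unfolding asymptotic_tuples_def mem_Collect_eq by (rule conjunct1)

lemma asymptotic_tuplesD:
  assumes "x \<in> asymptotic_tuples G \<phi> X k" "\<epsilon> > 0"
  shows "\<exists>F. finite F \<and> F \<subseteq> carrier G \<and> (\<forall>g\<in>carrier G - F. \<forall>i\<in>{1..k}. \<forall>j\<in>{1..k}.
      dist (\<phi> g (x i)) (\<phi> g (x j)) \<le> \<epsilon>)"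
  using assms(1)[unfolded asymptotic_tuples_def mem_Collect_eq, THEN conjunct2] assms(2) by (elim allE impE)

section \<open>Expansivity and asymptotic tuples for actions on compact spaces\<close>

locale compact_action = group_action G X \<phi>
  for G :: "('g, 'b) monoid_scheme" (structure)
    and X :: "'x::metric_space set" and \<phi> +
  assumes compact: "compact X"
    and continuous: "g \<in> carrier G \<Longrightarrow> continuous_on X (\<phi> g)"
begin

sublocale group G
  using group_hom group_hom.axioms(1) by auto

lemma maps_to [simp]: "g \<in> carrier G \<Longrightarrow> x \<in> X \<Longrightarrow> \<phi> g x \<in> X"
  using element_image by blast

lemma dist_on_leI:
  assumes "\<And>g. g \<in> K \<Longrightarrow> dist (\<phi> g x) (\<phi> g y) \<le> \<delta>" "0 \<le> \<delta>"
  shows "dist_on \<phi> K x y \<le> \<delta>"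
  unfolding dist_on_def using assms by (intro cSup_least) auto

lemma dist_on_leD:
  assumes "dist_on \<phi> K x y \<le> \<delta>" "K \<subseteq> carrier G" "x \<in> X" "y \<in> X" "g \<in> K"
  shows "dist (\<phi> g x) (\<phi> g y) \<le> \<delta>"
proof -
  \<comment> \<open>Compactness bounds all distances, so the \<open>Sup\<close> over a possibly
    infinite \<open>K\<close> is a genuine upper bound and not an unspecified value.\<close>
  obtain B where B: "\<And>u v. u \<in> X \<Longrightarrow> v \<in> X \<Longrightarrow> dist u v \<le> B"
    using compact_imp_bounded[OF compact] by (meson bounded_two_points)
  have "bdd_above (insert 0 ((\<lambda>g. dist (\<phi> g x) (\<phi> g y)) ` K))"
    using assms B maps_to by (subst bdd_above_insert) (auto intro!: bdd_aboveI2[of _ _ B])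
  then have "dist (\<phi> g x) (\<phi> g y) \<le> dist_on \<phi> K x y"
    unfolding dist_on_def using assms(5) by (intro cSup_upper) auto
  then show ?thesis
    using assms(1) by linarith
qed

text \<open>Compactness upgrades expansivity: the pairs at distance at least
  \<open>\<epsilon>\<close> form a compact set, and the closed conditions of being
  \<open>c\<close>-close at \<open>g\<close> have no common point in it, so finitely many
  \<open>g\<close> already suffice.\<close>

lemma uniform_expansive:
  assumes exp: "\<And>x y. x \<in> X \<Longrightarrow> y \<in> X \<Longrightarrow> x \<noteq> y \<Longrightarrow> \<exists>g\<in>carrier G. dist (\<phi> g x) (\<phi> g y) > c"
    and "\<epsilon> > 0"
  obtains W where "finite W" "W \<subseteq> carrier G"
    "\<And>x y. x \<in> X \<Longrightarrow> y \<in> X \<Longrightarrow> (\<And>g. g \<in> W \<Longrightarrow> dist (\<phi> g x) (\<phi> g y) \<le> c) \<Longrightarrow> dist x y < \<epsilon>"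
proof (rule ccontr)
  assume no: "\<not> thesis"
  note witness = that
  have bad: "\<exists>x\<in>X. \<exists>y\<in>X. (\<forall>g\<in>W. dist (\<phi> g x) (\<phi> g y) \<le> c) \<and> dist x y \<ge> \<epsilon>"
    if "finite W" "W \<subseteq> carrier G" for W
    using no witness[OF that] by (meson not_less)
  define S where "S = (X \<times> X) \<inter> (\<lambda>p. dist (fst p) (snd p)) -` {\<epsilon>..}"
  define E where "E g = (X \<times> X) \<inter> (\<lambda>p. dist (\<phi> g (fst p)) (\<phi> g (snd p))) -` {..c}" for g
  have closed: "closed (X \<times> X)"
    using compact by (simp add: compact_Times compact_imp_closed)
  have "closed S"
    unfolding S_def by (intro continuous_closed_preimage continuous_intros closed)
  then have "compact ((X \<times> X) \<inter> S)"
    using compact by (intro compact_Int_closed compact_Times)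
  moreover have "(X \<times> X) \<inter> S = S"
    by (auto simp: S_def)
  ultimately have "compact S"
    by simp
  moreover have "closed (E g)" if "g \<in> carrier G" for g
    unfolding E_def using that
    by (intro continuous_closed_preimage continuous_intros closed
        continuous_on_compose2[OF continuous]) auto
  moreover have "S \<inter> (\<Inter>g\<in>W. E g) \<noteq> {}" if W: "finite W" "W \<subseteq> carrier G" for W
  proof -
    obtain x y where "x \<in> X" "y \<in> X" "\<forall>g\<in>W. dist (\<phi> g x) (\<phi> g y) \<le> c" "dist x y \<ge> \<epsilon>"
      using bad[OF W] by blast
    then have "(x, y) \<in> S \<inter> (\<Inter>g\<in>W. E g)"
      by (auto simp: S_def E_def)
    then show ?thesis
      by blast
  qed
  \<comment> \<open>If every finite \<open>W\<close> failed, the finite intersection property would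
    produce two distinct points that no group element separates beyond \<open>c\<close>.\<close>
  ultimately have "S \<inter> (\<Inter>g\<in>carrier G. E g) \<noteq> {}"
    by (rule compact_imp_fip_image)
  then obtain x y where xy: "(x, y) \<in> S" "\<And>g. g \<in> carrier G \<Longrightarrow> (x, y) \<in> E g"
    by auto
  have "x \<in> X" "y \<in> X" "x \<noteq> y"
    using xy(1) \<open>\<epsilon> > 0\<close> by (auto simp: S_def)
  then obtain g where "g \<in> carrier G" "dist (\<phi> g x) (\<phi> g y) > c"
    using exp by blast
  then show False
    using xy(2)[of g] by (auto simp: E_def)
qed

text \<open>Uniform expansivity turns \<open>c\<close>-closeness on a finite window
  \<open>W g\<close> into \<open>\<epsilon>\<close>-closeness at \<open>g\<close>. Hence closeness
  at the single scale \<open>c\<close> off a finite set already yields asymptoticity at all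
  scales.\<close>

lemma asymptotic_tuplesI:
  assumes exp: "\<And>x y. x \<in> X \<Longrightarrow> y \<in> X \<Longrightarrow> x \<noteq> y \<Longrightarrow> \<exists>g\<in>carrier G. dist (\<phi> g x) (\<phi> g y) > c"
    and x: "x \<in> {1..k} \<rightarrow>\<^sub>E X" and A: "finite A" "A \<subseteq> carrier G"
    and close: "\<And>g i j. g \<in> carrier G - A \<Longrightarrow> i \<in> {1..k} \<Longrightarrow> j \<in> {1..k} \<Longrightarrow>
      dist (\<phi> g (x i)) (\<phi> g (x j)) \<le> c"
  shows "x \<in> asymptotic_tuples G \<phi> X k"
  unfolding asymptotic_tuples_def
proof (intro CollectI conjI x allI impI)
  fix \<epsilon> :: real
  assume "\<epsilon> > 0"
  then obtain W where W: "finite W" "W \<subseteq> carrier G"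
    "\<And>x y. x \<in> X \<Longrightarrow> y \<in> X \<Longrightarrow> (\<And>g. g \<in> W \<Longrightarrow> dist (\<phi> g x) (\<phi> g y) \<le> c) \<Longrightarrow> dist x y < \<epsilon>"
    using uniform_expansive[OF exp] by blast
  \<comment> \<open>The inverses of \<open>W\<close> times \<open>A\<close>: exactly the
    \<open>g\<close> whose window \<open>W g\<close> meets \<open>A\<close>.\<close>
  let ?F = "(\<lambda>w. inv w) ` W <#> A"
  show "\<exists>F. finite F \<and> F \<subseteq> carrier G \<and> (\<forall>g\<in>carrier G - F. \<forall>i\<in>{1..k}. \<forall>j\<in>{1..k}.
      dist (\<phi> g (x i)) (\<phi> g (x j)) \<le> \<epsilon>)"
  proof (intro exI[of _ ?F] conjI ballI)
    show "finite ?F"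
      using W A by (simp add: set_mult_def)
    show "?F \<subseteq> carrier G"
      using W A by (intro set_mult_closed) auto
    fix g i j
    assume g: "g \<in> carrier G - ?F" and ij: "i \<in> {1..k}" "j \<in> {1..k}"
    have xX: "x i \<in> X" "x j \<in> X"
      using x ij by auto
    have "dist (\<phi> w (\<phi> g (x i))) (\<phi> w (\<phi> g (x j))) \<le> c" if w: "w \<in> W" for w
    proof -
      have wg: "w \<in> carrier G" "g \<in> carrier G"
        using w W g by auto
      then have "inv w \<otimes> (w \<otimes> g) = g"
        by (simp add: m_assoc[symmetric])
      then have "w \<otimes> g \<notin> A"
        using g w unfolding set_mult_def by force
      then show ?thesis
        using close[of "w \<otimes> g" i j] wg xX ij by (simp add: composition_rule)
    qed
    then show "dist (\<phi> g (x i)) (\<phi> g (x j)) \<le> \<epsilon>"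
      using W(3)[of "\<phi> g (x i)" "\<phi> g (x j)"] xX g by force
  qed
qed

text \<open>Acting by \<open>g\<close> on the translate is acting by \<open>g \<otimes> s\<close> on
  the original tuple, so an exceptional set \<open>F\<close> becomes \<open>F\<close> times
  \<open>inv s\<close>.\<close>

lemma asymptotic_tuples_translate:
  assumes "x \<in> asymptotic_tuples G \<phi> X k" "s \<in> carrier G"
  shows "(\<lambda>i\<in>{1..k}. \<phi> s (x i)) \<in> asymptotic_tuples G \<phi> X k"
proof -
  have x: "x \<in> {1..k} \<rightarrow>\<^sub>E X"
    by (rule asymptotic_tuples_mem[OF assms(1)])
  have "\<exists>F. finite F \<and> F \<subseteq> carrier G \<and> (\<forall>g\<in>carrier G - F. \<forall>i\<in>{1..k}. \<forall>j\<in>{1..k}.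
      dist (\<phi> g (\<phi> s (x i))) (\<phi> g (\<phi> s (x j))) \<le> \<epsilon>)" if \<epsilon>: "\<epsilon> > 0" for \<epsilon>
  proof -
    obtain F where F: "finite F" "F \<subseteq> carrier G"
      "\<And>g i j. g \<in> carrier G - F \<Longrightarrow> i \<in> {1..k} \<Longrightarrow> j \<in> {1..k} \<Longrightarrow>
        dist (\<phi> g (x i)) (\<phi> g (x j)) \<le> \<epsilon>"
      using asymptotic_tuplesD[OF assms(1) \<epsilon>] by metis
    show ?thesis
    proof (intro exI[of _ "(\<lambda>g. g \<otimes> inv s) ` F"] conjI ballI)
      show "finite ((\<lambda>g. g \<otimes> inv s) ` F)" "(\<lambda>g. g \<otimes> inv s) ` F \<subseteq> carrier G"
        using F assms(2) by auto
      fix g i j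
      assume g: "g \<in> carrier G - (\<lambda>g. g \<otimes> inv s) ` F" and ij: "i \<in> {1..k}" "j \<in> {1..k}"
      have "g = g \<otimes> s \<otimes> inv s"
        using g assms(2) by (simp add: m_assoc)
      then have "g \<otimes> s \<notin> F"
        using g by blast
      then have "dist (\<phi> (g \<otimes> s) (x i)) (\<phi> (g \<otimes> s) (x j)) \<le> \<epsilon>"
        using F(3) g ij assms(2) by simp
      then show "dist (\<phi> g (\<phi> s (x i))) (\<phi> g (\<phi> s (x j))) \<le> \<epsilon>"
        using PiE_mem[OF x ij(1)] PiE_mem[OF x ij(2)] g assms(2) by (simp add: composition_rule)
    qed
  qed
  then show ?thesis
    unfolding asymptotic_tuples_def mem_Collect_eq
  proof (intro conjI allI impI)
    show "(\<lambda>i\<in>{1..k}. \<phi> s (x i)) \<in> {1..k} \<rightarrow>\<^sub>E X"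
      using PiE_mem[OF x] assms(2) by simp
  qed simp
qed

section \<open>Counting orbit patterns and gluing\<close>

text \<open>Each orbit segment over \<open>B\<close> is coded by nearby centres of a finite
  \<open>\<delta>/2\<close>-net; some code has a fibre of at least average size, and points with
  equal codes are \<open>\<delta>\<close>-close on \<open>B\<close>. As \<open>M\<close> depends on
  \<open>\<delta>\<close> alone, a boundary of size o(|A|) costs only a subexponential
  factor.\<close>

lemma pigeonhole_close:
  assumes "\<delta> > 0"
  obtains M :: nat where "M \<ge> 1"
    "\<And>B S (p :: 'i \<Rightarrow> 'x). \<lbrakk>finite B; B \<subseteq> carrier G; finite S; p \<in> S \<rightarrow> X\<rbrakk> \<Longrightarrow>
      \<exists>T\<subseteq>S. card S \<le> card T * M ^ card B \<and>
        (\<forall>s\<in>T. \<forall>t\<in>T. \<forall>g\<in>B. dist (\<phi> g (p s)) (\<phi> g (p t)) \<le> \<delta>)"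
proof -
  obtain C where C: "finite C" "X \<subseteq> (\<Union>c\<in>C. ball c (\<delta>/2))"
    using compact assms unfolding compact_eq_totally_bounded by (meson half_gt_zero)
  define near where "near x = (SOME c. c \<in> C \<and> dist c x < \<delta>/2)" for x
  have near: "near x \<in> C" "dist (near x) x < \<delta>/2" if "x \<in> X" for x
  proof -
    have "\<exists>c. c \<in> C \<and> dist c x < \<delta>/2"
      using C(2) that by (fastforce simp: mem_ball simp del: less_divide_eq_numeral1)
    from someI_ex[OF this] show "near x \<in> C" "dist (near x) x < \<delta>/2"
      by (auto simp: near_def)
  qed
  show ?thesis
  \<comment> \<open>The net may be empty when \<open>X\<close> is; the maximum keeps
    \<open>M \<ge> 1\<close>, which later makes \<open>ln M\<close> nonnegative.\<close>
  proof (rule that[of "max 1 (card C)"])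
    fix B S and p :: "'i \<Rightarrow> 'x"
    assume B: "finite B" "B \<subseteq> carrier G" and S: "finite S" "p \<in> S \<rightarrow> X"
    show "\<exists>T\<subseteq>S. card S \<le> card T * max 1 (card C) ^ card B \<and>
        (\<forall>s\<in>T. \<forall>t\<in>T. \<forall>g\<in>B. dist (\<phi> g (p s)) (\<phi> g (p t)) \<le> \<delta>)"
    proof (cases "S = {}")
      case False
      define code where "code s = (\<lambda>g\<in>B. near (\<phi> g (p s)))" for s
      have code: "code \<in> S \<rightarrow> (B \<rightarrow>\<^sub>E C)"
        using S B by (auto simp: code_def Pi_iff subset_iff intro!: near(1))
      moreover have "B \<rightarrow>\<^sub>E C \<noteq> {}"
        using code False by blast
      ultimately obtain y where "card S \<le> card (code -` {y} \<inter> S) * card (B \<rightarrow>\<^sub>E C)"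
        using pigeonhole_card[of code S "B \<rightarrow>\<^sub>E C"] S B C by (auto intro: finite_PiE)
      also have "card (B \<rightarrow>\<^sub>E C) = card C ^ card B"
        using B by (simp add: card_PiE)
      also have "\<dots> \<le> max 1 (card C) ^ card B"
        by (intro power_mono) auto
      finally have "card S \<le> card (code -` {y} \<inter> S) * max 1 (card C) ^ card B"
        by simp
      moreover have "dist (\<phi> g (p s)) (\<phi> g (p t)) \<le> \<delta>"
        if "s \<in> code -` {y} \<inter> S" "t \<in> code -` {y} \<inter> S" "g \<in> B" for s t g
      proof -
        have X: "\<phi> g (p s) \<in> X" "\<phi> g (p t) \<in> X"
          using that B S by (auto simp: Pi_iff subset_iff)
        have "code s g = code t g"
          using that by auto
        then have "near (\<phi> g (p s)) = near (\<phi> g (p t))"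
          using that by (simp add: code_def)
        then show ?thesis
          using near(2)[OF X(1)] near(2)[OF X(2)]
            dist_triangle3[of "\<phi> g (p s)" "\<phi> g (p t)" "near (\<phi> g (p t))"] by simp
      qed
      ultimately show ?thesis
        by (intro exI[of _ "code -` {y} \<inter> S"]) auto
    qed auto
  qed auto
qed

text \<open>All the selected points agree approximately on \<open>K A - A\<close>; gluing each of them to the exterior of one
  and the same point makes the results asymptotic to each other.\<close>

lemma strong_Markov_gluing:
  assumes "strong_topological_Markov G \<phi> X" "\<epsilon> > 0"
  obtains M :: nat and K where "M \<ge> 1" "finite K" "K \<subseteq> carrier G" "K \<noteq> {}"
    "\<And>A S (p :: 'i \<Rightarrow> 'x). \<lbrakk>finite A; A \<subseteq> carrier G; finite S; p \<in> S \<rightarrow> X\<rbrakk> \<Longrightarrow>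
      \<exists>T\<subseteq>S. card S \<le> card T * M ^ card ((K <#> A) - A) \<and>
        (\<exists>z\<in>T \<rightarrow> X. (\<forall>t\<in>T. \<forall>g\<in>A. dist (\<phi> g (p t)) (\<phi> g (z t)) \<le> \<epsilon>) \<and>
           (\<forall>s\<in>T. \<forall>t\<in>T. \<forall>g\<in>carrier G - A. dist (\<phi> g (z s)) (\<phi> g (z t)) \<le> \<epsilon>))"
proof -
  \<comment> \<open>Two glued points are compared through a common reference orbit, which costs one
    half of \<open>\<epsilon>\<close> for each.\<close>
  have "\<epsilon>/2 > 0"
    using assms(2) by simp
  then obtain \<delta> K where \<delta>: "\<delta> > 0" and K: "finite K" "K \<subseteq> carrier G" "\<one> \<in> K"
    and mem: "\<And>A. finite A \<Longrightarrow> A \<subseteq> carrier G \<Longrightarrow> memory_set G \<phi> X (\<epsilon>/2) \<delta> A (K <#> A)"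
    using assms(1) unfolding strong_topological_Markov_def by metis
  obtain M :: nat where M: "M \<ge> 1"
    "\<And>B S (p :: 'i \<Rightarrow> 'x). \<lbrakk>finite B; B \<subseteq> carrier G; finite S; p \<in> S \<rightarrow> X\<rbrakk> \<Longrightarrow>
      \<exists>T\<subseteq>S. card S \<le> card T * M ^ card B \<and>
        (\<forall>s\<in>T. \<forall>t\<in>T. \<forall>g\<in>B. dist (\<phi> g (p s)) (\<phi> g (p t)) \<le> \<delta>)"
    using pigeonhole_close[OF \<delta>] by metis
  show ?thesis
  proof (rule that[OF M(1) K(1,2)])
    show "K \<noteq> {}"
      using K by auto
    fix A S and p :: "'i \<Rightarrow> 'x"
    assume A: "finite A" "A \<subseteq> carrier G" and S: "finite S" "p \<in> S \<rightarrow> X"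
    have KA: "finite (K <#> A)" "K <#> A \<subseteq> carrier G" "A \<subseteq> K <#> A"
      using mem[OF A] by (auto simp: memory_set_def)
    have "finite ((K <#> A) - A)" "(K <#> A) - A \<subseteq> carrier G"
      using KA by auto
    from M(2)[OF this S] obtain T where T: "T \<subseteq> S" "card S \<le> card T * M ^ card ((K <#> A) - A)"
      and close: "\<And>s t g. s \<in> T \<Longrightarrow> t \<in> T \<Longrightarrow> g \<in> (K <#> A) - A \<Longrightarrow>
        dist (\<phi> g (p s)) (\<phi> g (p t)) \<le> \<delta>"
      by blast
    have pX: "p t \<in> X" if "t \<in> T" for t
      using that T S by auto
    have "\<exists>z\<in>T \<rightarrow> X. (\<forall>t\<in>T. \<forall>g\<in>A. dist (\<phi> g (p t)) (\<phi> g (z t)) \<le> \<epsilon>) \<and>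
           (\<forall>s\<in>T. \<forall>t\<in>T. \<forall>g\<in>carrier G - A. dist (\<phi> g (z s)) (\<phi> g (z t)) \<le> \<epsilon>)"
    proof (cases "T = {}")
      case False
      \<comment> \<open>The orbit of \<open>p t0\<close> off \<open>A\<close> serves as the common
        exterior: the memory property is applied to \<open>p t\<close> inside and
        \<open>p t0\<close> outside.\<close>
      then obtain t0 where t0: "t0 \<in> T"
        by auto
      have "\<exists>z\<in>X. dist_on \<phi> (K <#> A) (p t) z \<le> \<epsilon>/2 \<and>
          dist_on \<phi> (carrier G - A) (p t0) z \<le> \<epsilon>/2" if "t \<in> T" for t
      proof -
        have "dist_on \<phi> ((K <#> A) - A) (p t) (p t0) \<le> \<delta>"
          using close that t0 \<delta> by (intro dist_on_leI) auto
        then show ?thesis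
          using mem[OF A] pX[OF that] pX[OF t0] unfolding memory_set_def by blast
      qed
      then obtain z where z: "\<And>t. t \<in> T \<Longrightarrow> z t \<in> X"
        "\<And>t. t \<in> T \<Longrightarrow> dist_on \<phi> (K <#> A) (p t) (z t) \<le> \<epsilon>/2"
        "\<And>t. t \<in> T \<Longrightarrow> dist_on \<phi> (carrier G - A) (p t0) (z t) \<le> \<epsilon>/2"
        by metis
      have "dist (\<phi> g (p t)) (\<phi> g (z t)) \<le> \<epsilon>" if "t \<in> T" "g \<in> A" for t g
      proof -
        have "dist (\<phi> g (p t)) (\<phi> g (z t)) \<le> \<epsilon>/2"
          using dist_on_leD[OF z(2) KA(2)] pX z(1) that KA(3) by blast
        then show ?thesis
          using \<open>\<epsilon> > 0\<close> by linarith
      qed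
      moreover have "dist (\<phi> g (z s)) (\<phi> g (z t)) \<le> \<epsilon>"
        if "s \<in> T" "t \<in> T" "g \<in> carrier G - A" for s t g
      proof -
        have "dist (\<phi> g (p t0)) (\<phi> g (z u)) \<le> \<epsilon>/2" if "u \<in> T" for u
          using dist_on_leD[OF z(3) Diff_subset] pX t0 z(1) that \<open>g \<in> carrier G - A\<close> by blast
        then show ?thesis
          using that dist_triangle3[of "\<phi> g (z s)" "\<phi> g (z t)" "\<phi> g (p t0)"]
          by (smt (verit) field_sum_of_halves)
      qed
      ultimately show ?thesis
        using z(1) by (intro bexI[of _ z]) auto
    qed auto
    then show "\<exists>T\<subseteq>S. card S \<le> card T * M ^ card ((K <#> A) - A) \<and>
        (\<exists>z\<in>T \<rightarrow> X. (\<forall>t\<in>T. \<forall>g\<in>A. dist (\<phi> g (p t)) (\<phi> g (z t)) \<le> \<epsilon>) \<and>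
           (\<forall>s\<in>T. \<forall>t\<in>T. \<forall>g\<in>carrier G - A. dist (\<phi> g (z s)) (\<phi> g (z t)) \<le> \<epsilon>))"
      using T by blast
  qed
qed

section \<open>Positive entropy\<close>

text \<open>Take \<open>r\<close> to be a Lebesgue number of the cover. A maximal
  \<open>r\<close>-separated set along \<open>A\<close> is also \<open>r\<close>-spanning, so its
  orbit balls select a subcover of the join with at most as many members as the set has
  points.\<close>

lemma exists_separated_set:
  assumes "open_cover X \<U>"
  obtains r where "r > 0"
    "\<And>A. finite A \<Longrightarrow> A \<subseteq> carrier G \<Longrightarrow> \<exists>S\<subseteq>X. finite S \<and>
      min_subcover_card X (cover_join \<phi> X \<U> A) \<le> card S \<and>
      (\<forall>x\<in>S. \<forall>y\<in>S. x \<noteq> y \<longrightarrow> (\<exists>g\<in>A. dist (\<phi> g x) (\<phi> g y) \<ge> r))"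
proof -
  \<comment> \<open>The members of the cover are open only relative to \<open>X\<close>; the
    Lebesgue number lemma is applied to their open extensions.\<close>
  define \<W> where "\<W> = {W. open W \<and> X \<inter> W \<in> \<U>}"
  have "X \<subseteq> \<Union>\<W>"
  proof
    fix x
    assume "x \<in> X"
    then obtain U where "U \<in> \<U>" "x \<in> U"
      using assms by (auto simp: open_cover_def)
    moreover then obtain W where "open W" "U = X \<inter> W"
      using assms by (auto simp: open_cover_def openin_open)
    ultimately show "x \<in> \<Union>\<W>"
      by (auto simp: \<W>_def)
  qed
  then obtain r where r: "r > 0" "\<And>x. x \<in> X \<Longrightarrow> \<exists>W\<in>\<W>. ball x r \<subseteq> W"
    by (rule Heine_Borel_lemma[OF compact]) (auto simp: \<W>_def)
  have leb: "\<exists>U\<in>\<U>. X \<inter> ball x r \<subseteq> U" if x: "x \<in> X" for x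
  proof -
    obtain W where "X \<inter> W \<in> \<U>" "ball x r \<subseteq> W"
      using r(2)[OF x] by (auto simp: \<W>_def)
    then show ?thesis
      by blast
  qed
  show ?thesis
  proof (rule that[OF r(1)])
    fix A
    assume A: "finite A" "A \<subseteq> carrier G"
    define sep where "sep S \<longleftrightarrow> S \<subseteq> X \<and> finite S \<and>
      (\<forall>x\<in>S. \<forall>y\<in>S. x \<noteq> y \<longrightarrow> (\<exists>g\<in>A. dist (\<phi> g x) (\<phi> g y) \<ge> r))" for S
    obtain M :: nat where M:
      "\<And>B S (p :: 'x \<Rightarrow> 'x). \<lbrakk>finite B; B \<subseteq> carrier G; finite S; p \<in> S \<rightarrow> X\<rbrakk> \<Longrightarrow>
      \<exists>T\<subseteq>S. card S \<le> card T * M ^ card B \<and>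
        (\<forall>s\<in>T. \<forall>t\<in>T. \<forall>g\<in>B. dist (\<phi> g (p s)) (\<phi> g (p t)) \<le> r/2)"
      using pigeonhole_close[of "r/2"] r(1) by (metis half_gt_zero)
    \<comment> \<open>A separated set of greatest cardinality exists because sizes are bounded: in
      the pigeonhole at scale \<open>r/2\<close> a class of pairwise close points contains at most
      one point of a separated set.\<close>
    have "card S < M ^ card A + 1" if "sep S" for S
    proof -
      have "(\<lambda>x. x) \<in> S \<rightarrow> X" "finite S"
        using that by (auto simp: sep_def)
      from M[OF A this(2,1)] obtain T where T: "T \<subseteq> S" "card S \<le> card T * M ^ card A"
        "\<And>s t g. s \<in> T \<Longrightarrow> t \<in> T \<Longrightarrow> g \<in> A \<Longrightarrow> dist (\<phi> g s) (\<phi> g t) \<le> r/2"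
        by blast
      have "s = t" if st: "s \<in> T" "t \<in> T" for s t
      proof (rule ccontr)
        assume "s \<noteq> t"
        then obtain g where "g \<in> A" "dist (\<phi> g s) (\<phi> g t) \<ge> r"
          using \<open>sep S\<close> st T(1) unfolding sep_def by blast
        then show False
          using T(3)[OF st] r(1) by fastforce
      qed
      then have "card T \<le> 1"
        using \<open>finite S\<close> T(1) by (metis One_nat_def card_le_Suc0_iff_eq finite_subset)
      then show ?thesis
        using T(2) by (metis add.commute less_one mult_1 mult_le_mono1 not_less_eq order.trans
            plus_1_eq_Suc less_Suc_eq_le)
    qed
    moreover have "sep {}"
      by (simp add: sep_def)
    ultimately obtain S where S: "sep S" "\<And>S'. sep S' \<Longrightarrow> card S' \<le> card S"
      using ex_has_greatest_nat[of sep "{}" card "M ^ card A + 1"] by blast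
    \<comment> \<open>A point not shadowed by \<open>S\<close> could be added to it, contradicting
      maximality.\<close>
    have span: "\<exists>y\<in>S. \<forall>g\<in>A. dist (\<phi> g y) (\<phi> g x) < r" if x: "x \<in> X" for x
    proof (rule ccontr)
      assume "\<not> ?thesis"
      then have far: "\<forall>y\<in>S. \<exists>g\<in>A. dist (\<phi> g y) (\<phi> g x) \<ge> r"
        by (meson not_less)
      show False
      proof (cases "x \<in> S")
        case True
        then show False
          using far r(1) by fastforce
      next
        case False
        have "sep (insert x S)"
          using S(1) x far by (auto simp: sep_def dist_commute)
        then have "card (insert x S) \<le> card S"
          by (rule S(2))
        moreover have "finite S"
          using S(1) by (simp add: sep_def)
        ultimately show False
          using False by simp
      qed
    qed
    have "\<exists>U. \<forall>y\<in>S. \<forall>g\<in>A. U y g \<in> \<U> \<and> X \<inter> ball (\<phi> g y) r \<subseteq> U y g"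
    proof -
      have "\<exists>U. y \<in> S \<longrightarrow> g \<in> A \<longrightarrow> U \<in> \<U> \<and> X \<inter> ball (\<phi> g y) r \<subseteq> U" for y g
        using leb[of "\<phi> g y"] S(1) A(2) by (auto simp: sep_def subset_iff)
      then show ?thesis
        by metis
    qed
    then obtain U where U: "\<And>y g. y \<in> S \<Longrightarrow> g \<in> A \<Longrightarrow> U y g \<in> \<U> \<and> X \<inter> ball (\<phi> g y) r \<subseteq> U y g"
      by blast
    \<comment> \<open>One member of the join per point \<open>y\<close> of \<open>S\<close>; it
      contains every point whose orbit stays \<open>r\<close>-close to that of \<open>y\<close>
      along \<open>A\<close>.\<close>
    let ?\<V> = "(\<lambda>y. \<Inter>g\<in>A. translate_preimage \<phi> X g (U y g)) ` S"
    have "?\<V> \<subseteq> cover_join \<phi> X \<U> A"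
      using U unfolding cover_join_def by blast
    moreover have "finite ?\<V>"
      using S(1) by (simp add: sep_def)
    moreover have "X \<subseteq> \<Union>?\<V>"
    proof
      fix x
      assume x: "x \<in> X"
      then obtain y where y: "y \<in> S" "\<forall>g\<in>A. dist (\<phi> g y) (\<phi> g x) < r"
        using span by blast
      have "\<phi> g x \<in> U y g" if "g \<in> A" for g
        using U[OF y(1) that] y(2) that x A(2) by (auto simp: subset_iff)
      then show "x \<in> \<Union>?\<V>"
        using y(1) x by (auto simp: translate_preimage_def)
    qed
    ultimately have "min_subcover_card X (cover_join \<phi> X \<U> A) \<le> card ?\<V>"
      unfolding min_subcover_card_def by (intro Least_le) blast
    also have "\<dots> \<le> card S"
      using S(1) by (intro card_image_le) (simp add: sep_def)
    finally show "\<exists>S\<subseteq>X. finite S \<and>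
      min_subcover_card X (cover_join \<phi> X \<U> A) \<le> card S \<and>
      (\<forall>x\<in>S. \<forall>y\<in>S. x \<noteq> y \<longrightarrow> (\<exists>g\<in>A. dist (\<phi> g x) (\<phi> g y) \<ge> r))"
      using S(1) unfolding sep_def by blast
  qed
qed

text \<open>The separated set grows at rate above \<open>l/2\<close>, the boundary pigeonhole
  consumes at most \<open>l/4\<close>, and the surplus leaves at least \<open>k\<close> points in
  one class.\<close>

theorem positive_entropy_imp_distinct_asymptotic_tuple:
  assumes "expansive G \<phi> X" "strong_topological_Markov G \<phi> X" "infinite (carrier G)"
    and "left_Folner G F" "top_entropy \<phi> X F > 0"
  shows "\<exists>x\<in>asymptotic_tuples G \<phi> X k. inj_on x {1..k}"
proof -
  obtain c where c: "c > 0"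
    "\<And>x y. x \<in> X \<Longrightarrow> y \<in> X \<Longrightarrow> x \<noteq> y \<Longrightarrow> \<exists>g\<in>carrier G. dist (\<phi> g x) (\<phi> g y) > c"
    using assms(1) unfolding expansive_def by blast
  obtain l \<U> where l: "l > 0" and \<U>: "open_cover X \<U>"
    and lim: "(\<lambda>n. ln (real (min_subcover_card X (cover_join \<phi> X \<U> (F n)))) / real (card (F n)))
      \<longlonglongrightarrow> l"
    using assms(5) unfolding top_entropy_def less_Sup_iff by (auto simp flip: zero_ereal_def)
  obtain r where r: "r > 0"
    "\<And>A. finite A \<Longrightarrow> A \<subseteq> carrier G \<Longrightarrow> \<exists>S\<subseteq>X. finite S \<and>
      min_subcover_card X (cover_join \<phi> X \<U> A) \<le> card S \<and>
      (\<forall>x\<in>S. \<forall>y\<in>S. x \<noteq> y \<longrightarrow> (\<exists>g\<in>A. dist (\<phi> g x) (\<phi> g y) \<ge> r))"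
    using exists_separated_set[OF \<U>] by metis
  \<comment> \<open>The bound \<open>c\<close> feeds the asymptoticity criterion; \<open>r/3\<close>
    ensures \<open>2 * \<epsilon> < r\<close>, so that gluing cannot merge separated points.\<close>
  define \<epsilon> where "\<epsilon> = min c (r/3)"
  have "\<epsilon> > 0"
    using c r by (simp add: \<epsilon>_def)
  obtain M :: nat and K where M: "M \<ge> 1" and K: "finite K" "K \<subseteq> carrier G" "K \<noteq> {}"
    and glue: "\<And>A S (p :: 'x \<Rightarrow> 'x). \<lbrakk>finite A; A \<subseteq> carrier G; finite S; p \<in> S \<rightarrow> X\<rbrakk> \<Longrightarrow>
      \<exists>T\<subseteq>S. card S \<le> card T * M ^ card ((K <#> A) - A) \<and>
        (\<exists>z\<in>T \<rightarrow> X. (\<forall>t\<in>T. \<forall>g\<in>A. dist (\<phi> g (p t)) (\<phi> g (z t)) \<le> \<epsilon>) \<and>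
           (\<forall>s\<in>T. \<forall>t\<in>T. \<forall>g\<in>carrier G - A. dist (\<phi> g (z s)) (\<phi> g (z t)) \<le> \<epsilon>))"
    using strong_Markov_gluing[OF assms(2) \<open>\<epsilon> > 0\<close>] by metis
  \<comment> \<open>Chosen so that the boundary loss \<open>\<tau> * ln M\<close> is at most
    \<open>l/4\<close>; the summand 1 avoids division by zero when \<open>M = 1\<close>.\<close>
  define \<tau> where "\<tau> = l / (4 * (ln M + 1))"
  have lnM: "ln (real M) \<ge> 0"
    using M by simp
  have \<tau>: "\<tau> > 0" "\<tau> * ln M \<le> l/4"
  proof -
    show "\<tau> > 0"
      using l lnM by (simp add: \<tau>_def)
    have "ln (real M) + 1 \<noteq> 0"
      using lnM by linarith
    then have "4 * (\<tau> * (ln M + 1)) = l"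
      by (simp add: \<tau>_def field_simps)
    then show "\<tau> * ln M \<le> l/4"
      using \<open>\<tau> > 0\<close> by (simp add: algebra_simps)
  qed
  have "\<forall>\<^sub>F n in sequentially.
      l/2 < ln (real (min_subcover_card X (cover_join \<phi> X \<U> (F n)))) / real (card (F n))"
    using lim l by (intro order_tendstoD) auto
  moreover have "\<forall>\<^sub>F n in sequentially. real (card ((K <#> F n) - F n)) \<le> \<tau> * real (card (F n))"
    by (intro left_Folner_boundary assms K \<tau>)
  \<comment> \<open>This size makes \<open>l/4 * card A\<close> at least \<open>k\<close>.\<close>
  moreover have "\<forall>\<^sub>F n in sequentially. nat \<lceil>4 * real k / l\<rceil> \<le> card (F n)"
    using left_Folner_card_at_top[OF assms(4,3)] unfolding filterlim_at_top by blast
  ultimately have "\<forall>\<^sub>F n in sequentially.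
      l/2 < ln (real (min_subcover_card X (cover_join \<phi> X \<U> (F n)))) / real (card (F n)) \<and>
      real (card ((K <#> F n) - F n)) \<le> \<tau> * real (card (F n)) \<and>
      nat \<lceil>4 * real k / l\<rceil> \<le> card (F n)"
    by eventually_elim blast
  then obtain n where n:
    "l/2 < ln (real (min_subcover_card X (cover_join \<phi> X \<U> (F n)))) / real (card (F n))"
    "real (card ((K <#> F n) - F n)) \<le> \<tau> * real (card (F n))"
    "nat \<lceil>4 * real k / l\<rceil> \<le> card (F n)"
    using eventually_happens'[OF sequentially_bot] by blast
  define A where "A = F n"
  have A: "finite A" "A \<subseteq> carrier G" "card A > 0"
    using assms(4) by (auto simp: left_Folner_def A_def card_gt_0_iff)
  define N where "N = min_subcover_card X (cover_join \<phi> X \<U> A)"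
  have lnN: "l/2 * card A < ln N"
    using n(1) A(3) by (simp add: A_def N_def field_simps)
  \<comment> \<open>Since \<open>ln 0 = 0\<close>, a zero count would contradict the positive lower
    bound.\<close>
  then have N: "N > 0"
    using A(3) l by (cases "N = 0") (auto simp: mult_less_0_iff)
  obtain S where S: "S \<subseteq> X" "finite S" "N \<le> card S"
    and sep: "\<And>x y. x \<in> S \<Longrightarrow> y \<in> S \<Longrightarrow> x \<noteq> y \<Longrightarrow> \<exists>g\<in>A. dist (\<phi> g x) (\<phi> g y) \<ge> r"
    using r(2)[OF A(1,2)] unfolding N_def by blast
  have "(\<lambda>x. x) \<in> S \<rightarrow> X"
    using S by auto
  from glue[OF A(1,2) S(2) this] obtain T z where T: "T \<subseteq> S" "card S \<le> card T * M ^ card ((K <#> A) - A)"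
    and z: "z \<in> T \<rightarrow> X" "\<And>t g. t \<in> T \<Longrightarrow> g \<in> A \<Longrightarrow> dist (\<phi> g t) (\<phi> g (z t)) \<le> \<epsilon>"
      "\<And>s t g. s \<in> T \<Longrightarrow> t \<in> T \<Longrightarrow> g \<in> carrier G - A \<Longrightarrow> dist (\<phi> g (z s)) (\<phi> g (z t)) \<le> \<epsilon>"
    by blast
  have "k \<le> card T"
  proof -
    define b where "b = card ((K <#> A) - A)"
    have "N \<le> card T * M ^ b"
      using S(3) T(2) by (simp add: b_def)
    then have T0: "card T > 0"
      using N by (cases "card T = 0") auto
    have "l/2 * card A < ln N"
      by (rule lnN)
    also have "\<dots> \<le> ln (real (card T * M ^ b))"
      using N T0 M \<open>N \<le> card T * M ^ b\<close> by (subst ln_le_cancel_iff) (auto simp flip: of_nat_mult of_nat_power)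
    also have "\<dots> = ln (card T) + b * ln M"
      using M T0 by (simp add: ln_mult ln_realpow)
    also have "b * ln M \<le> (\<tau> * card A) * ln M"
      using n(2) lnM by (intro mult_right_mono) (auto simp: A_def b_def)
    also have "\<dots> = (\<tau> * ln M) * card A"
      by simp
    also have "\<dots> \<le> l/4 * card A"
      using \<tau>(2) by (intro mult_right_mono) auto
    finally have "l/4 * card A < ln (card T)"
      by simp
    \<comment> \<open>The logarithm itself already exceeds \<open>k\<close>, so this crude bound
      suffices.\<close>
    also have "\<dots> \<le> card T"
      using T0 ln_le_minus_one[of "card T"] by simp
    finally have "l/4 * card A < card T" .
    moreover have "4 * k / l \<le> card A"
      using n(3) by (simp add: A_def nat_le_iff ceiling_le_iff)
    then have "k \<le> l/4 * card A"
      using l by (simp add: field_simps)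
    ultimately show ?thesis
      by linarith
  qed
  then obtain T' where T': "T' \<subseteq> T" "card T' = k" "finite T'"
    by (rule obtain_subset_with_card_n)
  then obtain h where h: "bij_betw h {1..k} T'"
    using ex_bij_betw_nat_finite_1 by blast
  have hT: "h i \<in> T" if "i \<in> {1..k}" for i
    using that h T'(1) by (auto simp: bij_betw_def)
  have inj_z: "inj_on z T"
  proof (rule inj_onI, rule ccontr)
    fix s t
    assume st: "s \<in> T" "t \<in> T" "z s = z t" "s \<noteq> t"
    then obtain g where g: "g \<in> A" "dist (\<phi> g s) (\<phi> g t) \<ge> r"
      using sep T(1) by blast
    have "dist (\<phi> g s) (\<phi> g t) \<le> dist (\<phi> g s) (\<phi> g (z s)) + dist (\<phi> g t) (\<phi> g (z t))"
      using st(3) by (metis dist_triangle2)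
    also have "\<dots> \<le> 2 * \<epsilon>"
      using z(2)[OF st(1) g(1)] z(2)[OF st(2) g(1)] by linarith
    also have "\<dots> < r"
      using r(1) by (simp add: \<epsilon>_def)
    finally show False
      using g(2) by linarith
  qed
  define x where "x = (\<lambda>i\<in>{1..k}. z (h i))"
  have "x \<in> asymptotic_tuples G \<phi> X k"
  proof (rule asymptotic_tuplesI[OF c(2) _ A(1,2)])
    show "x \<in> {1..k} \<rightarrow>\<^sub>E X"
      using z(1) hT by (auto simp: x_def)
    show "dist (\<phi> g (x i)) (\<phi> g (x j)) \<le> c"
      if "g \<in> carrier G - A" "i \<in> {1..k}" "j \<in> {1..k}" for g i j
      using z(3)[OF hT hT that(1), of i j] that by (simp add: x_def \<epsilon>_def)
  qed
  moreover have "inj_on x {1..k}"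
  proof (rule inj_onI)
    fix i j
    assume ij: "i \<in> {1..k}" "j \<in> {1..k}" "x i = x j"
    then have "h i = h j"
      using inj_onD[OF inj_z _ hT hT] by (simp add: x_def)
    then show "i = j"
      using inj_onD[OF bij_betw_imp_inj_on[OF h]] ij by blast
  qed
  ultimately show ?thesis
    by blast
qed

section \<open>Independence\<close>

text \<open>If no positive \<open>q\<close> were admissible, 0 would be the greatest admissible
  value and the density would vanish. This extracts a positive \<open>q\<close> without showing in
  general that \<open>GREATEST\<close> is attained.\<close>

lemma independence_density_posD:
  assumes "independence_density G \<phi> X k U > 0"
  obtains q where "q > 0"
    "\<And>F. finite F \<Longrightarrow> F \<subseteq> carrier G \<Longrightarrow>
      \<exists>J\<subseteq>F. real (card J) \<ge> q * real (card F) \<and> independence_set G \<phi> X k U J"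
proof (rule ccontr)
  assume no: "\<not> thesis"
  note witness = that
  let ?P = "\<lambda>q. q \<ge> 0 \<and> (\<forall>F. finite F \<and> F \<subseteq> carrier G \<longrightarrow>
        (\<exists>J\<subseteq>F. real (card J) \<ge> q * real (card F) \<and> independence_set G \<phi> X k U J))"
  have "independence_set G \<phi> X k U {}"
    by (auto simp: independence_set_def)
  then have "?P 0"
    by (auto intro!: exI[of _ "{}"])
  moreover have "q \<le> 0" if "?P q" for q
    using no witness[of q] that by (meson not_less)
  ultimately have "independence_density G \<phi> X k U = 0"
    unfolding independence_density_def by (rule Greatest_equality)
  then show False
    using assms by simp
qed

text \<open>If every coordinate missed some value, \<open>T\<close> would lie in a product of sets
  with at most \<open>k - 1\<close> elements each and be too small.\<close>

lemma exists_full_coordinate: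
  assumes "finite J" "k \<ge> 1" "T \<subseteq> J \<rightarrow>\<^sub>E {1..k}" "(k - 1) ^ card J < card T"
  obtains s where "s \<in> J" "\<And>i. i \<in> {1..k} \<Longrightarrow> \<exists>\<psi>\<in>T. \<psi> s = i"
proof (rule ccontr)
  assume no: "\<not> thesis"
  note witness = that
  have "card ((\<lambda>\<psi>. \<psi> s) ` T) \<le> k - 1" if s: "s \<in> J" for s
  proof -
    obtain i where i: "i \<in> {1..k}" "\<forall>\<psi>\<in>T. \<psi> s \<noteq> i"
      using no witness[OF s] by blast
    then have "(\<lambda>\<psi>. \<psi> s) ` T \<subseteq> {1..k} - {i}"
      using assms(3) s by (fastforce simp: PiE_iff)
    then have "card ((\<lambda>\<psi>. \<psi> s) ` T) \<le> card ({1..k} - {i})"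
      by (intro card_mono) auto
    also have "\<dots> = k - 1"
      using i by simp
    finally show ?thesis .
  qed
  then have "(\<Prod>s\<in>J. card ((\<lambda>\<psi>. \<psi> s) ` T)) \<le> (\<Prod>s\<in>J. k - 1)"
    by (intro prod_mono) auto
  moreover have "T \<subseteq> (\<Pi>\<^sub>E s\<in>J. (\<lambda>\<psi>. \<psi> s) ` T)"
    using assms(3) by (auto simp: PiE_iff)
  \<comment> \<open>Infinite sets have cardinality 0, so the strict lower bound on
    \<open>card T\<close> forces finiteness.\<close>
  moreover have "finite T"
    using assms(4) by (metis card.infinite not_less_zero)
  then have "finite (\<Pi>\<^sub>E s\<in>J. (\<lambda>\<psi>. \<psi> s) ` T)"
    using assms(1) by (intro finite_PiE) auto
  ultimately have "card T \<le> (\<Prod>s\<in>J. k - 1)"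
    using card_mono[of "\<Pi>\<^sub>E s\<in>J. (\<lambda>\<psi>. \<psi> s) ` T" T] assms(1)
    by (auto simp only: card_PiE intro: order_trans)
  then show False
    using assms(4) by simp
qed

text \<open>Independence realises all \<open>k ^ card J\<close> patterns, and the boundary
  pigeonhole is too weak to reduce them to \<open>(k - 1) ^ card J\<close>. Gluing perturbs orbits,
  so the tuple comes within \<open>\<eta>\<close> of the sets \<open>U i\<close> instead of inside
  them.\<close>

theorem positive_independence_density_imp_asymptotic_tuple:
  assumes "expansive G \<phi> X" "strong_topological_Markov G \<phi> X" "left_Folner G F"
    and "k \<ge> 2" "independence_density G \<phi> X k U > 0" "\<eta> > 0"
  shows "\<exists>x\<in>asymptotic_tuples G \<phi> X k. \<forall>i\<in>{1..k}. \<exists>u\<in>U i. dist u (x i) \<le> \<eta>"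
proof -
  obtain c where c: "c > 0"
    "\<And>x y. x \<in> X \<Longrightarrow> y \<in> X \<Longrightarrow> x \<noteq> y \<Longrightarrow> \<exists>g\<in>carrier G. dist (\<phi> g x) (\<phi> g y) > c"
    using assms(1) unfolding expansive_def by blast
  obtain q where q: "q > 0"
    "\<And>F. finite F \<Longrightarrow> F \<subseteq> carrier G \<Longrightarrow>
      \<exists>J\<subseteq>F. real (card J) \<ge> q * real (card F) \<and> independence_set G \<phi> X k U J"
    using independence_density_posD[OF assms(5)] by metis
  define \<epsilon> where "\<epsilon> = min c \<eta>"
  have "\<epsilon> > 0"
    using c assms(6) by (simp add: \<epsilon>_def)
  obtain M :: nat and K where M: "M \<ge> 1" and K: "finite K" "K \<subseteq> carrier G" "K \<noteq> {}"
    and glue: "\<And>A S (p :: ('g \<Rightarrow> nat) \<Rightarrow> 'x). \<lbrakk>finite A; A \<subseteq> carrier G; finite S; p \<in> S \<rightarrow> X\<rbrakk> \<Longrightarrow>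
      \<exists>T\<subseteq>S. card S \<le> card T * M ^ card ((K <#> A) - A) \<and>
        (\<exists>z\<in>T \<rightarrow> X. (\<forall>t\<in>T. \<forall>g\<in>A. dist (\<phi> g (p t)) (\<phi> g (z t)) \<le> \<epsilon>) \<and>
           (\<forall>s\<in>T. \<forall>t\<in>T. \<forall>g\<in>carrier G - A. dist (\<phi> g (z s)) (\<phi> g (z t)) \<le> \<epsilon>))"
    using strong_Markov_gluing[OF assms(2) \<open>\<epsilon> > 0\<close>] by metis
  \<comment> \<open>The exponential gain per element of \<open>J\<close> of
    \<open>k ^ card J\<close> over \<open>(k - 1) ^ card J\<close>.\<close>
  define \<kappa> where "\<kappa> = ln (real k) - ln (real (k - 1))"
  have \<kappa>: "\<kappa> > 0"
    using assms(4) by (simp add: \<kappa>_def)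
  \<comment> \<open>Balances the boundary cost \<open>\<tau> * ln M\<close> per element of
    \<open>A\<close> against the gain \<open>q * \<kappa>\<close>; the summand 1 makes the
    inequality strict.\<close>
  define \<tau> where "\<tau> = q * \<kappa> / (ln M + 1)"
  have lnM: "ln (real M) \<ge> 0"
    using M by simp
  have \<tau>: "\<tau> > 0"
    using q(1) \<kappa> lnM by (simp add: \<tau>_def)
  have "\<tau> * (ln M + 1) = q * \<kappa>"
    using lnM by (simp add: \<tau>_def)
  then have \<tau>_ln: "\<tau> * ln M < q * \<kappa>"
    using \<tau> by (simp add: algebra_simps)
  have "\<forall>\<^sub>F n in sequentially. real (card ((K <#> F n) - F n)) \<le> \<tau> * real (card (F n))"
    by (intro left_Folner_boundary assms K \<tau>)
  then obtain n where n: "real (card ((K <#> F n) - F n)) \<le> \<tau> * real (card (F n))"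
    using eventually_happens'[OF sequentially_bot] by blast
  define A where "A = F n"
  have A: "finite A" "A \<subseteq> carrier G" "card A > 0"
    using assms(3) by (auto simp: left_Folner_def A_def card_gt_0_iff)
  obtain J where J: "J \<subseteq> A" "real (card J) \<ge> q * real (card A)" "independence_set G \<phi> X k U J"
    using q(2)[OF A(1,2)] by blast
  have "q * real (card A) > 0"
    using q(1) A(3) by simp
  \<comment> \<open>Independence speaks only of nonempty index sets, and it is about to be used for
    all of \<open>J\<close>.\<close>
  then have "J \<noteq> {}"
    using J(2) by auto
  have fin_J: "finite J"
    using J(1) A(1) finite_subset by blast
  define \<Omega> where "\<Omega> = J \<rightarrow>\<^sub>E {1..k}"
  have "\<exists>x\<in>X. \<forall>s\<in>J. \<phi> s x \<in> U (\<psi> s)" if "\<psi> \<in> \<Omega>" for \<psi>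
  proof -
    have "\<psi> \<in> J \<rightarrow> {1..k}"
      using that by (auto simp: \<Omega>_def)
    then have "(\<Inter>s\<in>J. translate_preimage \<phi> X s (U (\<psi> s))) \<noteq> {}"
      using J(3) \<open>J \<noteq> {}\<close> fin_J unfolding independence_set_def by blast
    then show ?thesis
      using \<open>J \<noteq> {}\<close> by (auto simp: translate_preimage_def)
  qed
  then obtain p where p: "\<And>\<psi>. \<psi> \<in> \<Omega> \<Longrightarrow> p \<psi> \<in> X"
    "\<And>\<psi> s. \<psi> \<in> \<Omega> \<Longrightarrow> s \<in> J \<Longrightarrow> \<phi> s (p \<psi>) \<in> U (\<psi> s)"
    by metis
  have "finite \<Omega>" "p \<in> \<Omega> \<rightarrow> X"
    using fin_J p(1) by (auto simp: \<Omega>_def intro: finite_PiE)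
  from glue[OF A(1,2) this] obtain T z
    where T: "T \<subseteq> \<Omega>" "card \<Omega> \<le> card T * M ^ card ((K <#> A) - A)"
      and z: "z \<in> T \<rightarrow> X" "\<And>t g. t \<in> T \<Longrightarrow> g \<in> A \<Longrightarrow> dist (\<phi> g (p t)) (\<phi> g (z t)) \<le> \<epsilon>"
      "\<And>s t g. s \<in> T \<Longrightarrow> t \<in> T \<Longrightarrow> g \<in> carrier G - A \<Longrightarrow> dist (\<phi> g (z s)) (\<phi> g (z t)) \<le> \<epsilon>"
    by blast
  \<comment> \<open>Otherwise taking logarithms gives
    \<open>card J * \<kappa> \<le> b * ln M\<close>, while the choice of \<open>\<tau>\<close> makes
    the right side smaller than
    \<open>q * card A * \<kappa> \<le> card J * \<kappa>\<close>.\<close>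
  have "(k - 1) ^ card J < card T"
  proof (rule ccontr)
    define b where "b = card ((K <#> A) - A)"
    assume "\<not> ?thesis"
    then have "card \<Omega> \<le> (k - 1) ^ card J * M ^ b"
      using T(2) by (metis b_def mult_le_mono1 not_less order_trans)
    then have "real (k ^ card J) \<le> real ((k - 1) ^ card J * M ^ b)"
      using fin_J by (simp only: \<Omega>_def card_PiE prod_constant card_atLeastAtMost of_nat_le_iff) simp
    then have "ln (real (k ^ card J)) \<le> ln (real ((k - 1) ^ card J * M ^ b))"
      using assms(4) M by (subst ln_le_cancel_iff) auto
    then have "card J * ln k \<le> card J * ln (real (k - 1)) + b * ln M"
      using assms(4) M by (simp add: ln_mult ln_realpow)
    then have "card J * \<kappa> \<le> b * ln M"
      by (simp add: \<kappa>_def algebra_simps)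
    also have "\<dots> \<le> (\<tau> * card A) * ln M"
      using n lnM by (intro mult_right_mono) (auto simp: A_def b_def)
    also have "\<dots> = (\<tau> * ln M) * card A"
      by simp
    also have "\<dots> < (q * \<kappa>) * card A"
      using \<tau>_ln A(3) by (intro mult_strict_right_mono) auto
    also have "\<dots> = (q * card A) * \<kappa>"
      by simp
    also have "\<dots> \<le> card J * \<kappa>"
      using J(2) \<kappa> by (intro mult_right_mono) auto
    finally show False
      by simp
  qed
  then obtain s where s: "s \<in> J" "\<And>i. i \<in> {1..k} \<Longrightarrow> \<exists>\<psi>\<in>T. \<psi> s = i"
    using exists_full_coordinate[OF fin_J, of k T] T(1) assms(4) unfolding \<Omega>_def by auto
  then obtain \<psi> where \<psi>: "\<And>i. i \<in> {1..k} \<Longrightarrow> \<psi> i \<in> T" "\<And>i. i \<in> {1..k} \<Longrightarrow> \<psi> i s = i"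
    by metis
  have sA: "s \<in> A" "s \<in> carrier G"
    using s(1) J(1) A(2) by auto
  define y where "y = (\<lambda>i\<in>{1..k}. z (\<psi> i))"
  have "y \<in> asymptotic_tuples G \<phi> X k"
  proof (rule asymptotic_tuplesI[OF c(2) _ A(1,2)])
    show "y \<in> {1..k} \<rightarrow>\<^sub>E X"
      using z(1) \<psi>(1) by (auto simp: y_def)
    show "dist (\<phi> g (y i)) (\<phi> g (y j)) \<le> c"
      if "g \<in> carrier G - A" "i \<in> {1..k}" "j \<in> {1..k}" for g i j
      using z(3)[OF \<psi>(1) \<psi>(1) that(1), of i j] that by (simp add: y_def \<epsilon>_def)
  qed
  \<comment> \<open>Only at time \<open>s\<close> do the patterns \<open>\<psi> i\<close> show the
    values \<open>1..k\<close> in order, so the translate by \<open>s\<close> is the tuple that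
    approaches each \<open>U i\<close>.\<close>
  then have "(\<lambda>i\<in>{1..k}. \<phi> s (y i)) \<in> asymptotic_tuples G \<phi> X k"
    using sA(2) by (rule asymptotic_tuples_translate)
  moreover have "\<exists>u\<in>U i. dist u (\<phi> s (y i)) \<le> \<eta>" if i: "i \<in> {1..k}" for i
  proof (rule bexI)
    show "\<phi> s (p (\<psi> i)) \<in> U i"
      using p(2)[of "\<psi> i" s] T(1) \<psi> i s(1) by auto
    show "dist (\<phi> s (p (\<psi> i))) (\<phi> s (y i)) \<le> \<eta>"
      using z(2)[OF \<psi>(1)[OF i] sA(1)] i by (simp add: y_def \<epsilon>_def)
  qed
  then have "\<forall>i\<in>{1..k}. \<exists>u\<in>U i. dist u ((\<lambda>i\<in>{1..k}. \<phi> s (y i)) i) \<le> \<eta>"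
    by simp
  ultimately show ?thesis
    by blast
qed

section \<open>Density of asymptotic tuples from UPE\<close>

theorem UPE_imp_dense_asymptotic_tuples:
  assumes "expansive G \<phi> X" "strong_topological_Markov G \<phi> X" "left_Folner G F"
    and "k \<ge> 2" "UPE G \<phi> X k"
  shows "dense_in_power X k (asymptotic_tuples G \<phi> X k)"
  unfolding dense_in_power_def
proof
  let ?P = "product_topology (\<lambda>i. top_of_set X) {1..k}"
  show "?P closure_of asymptotic_tuples G \<phi> X k \<subseteq> {1..k} \<rightarrow>\<^sub>E X"
    using closure_of_subset_topspace[of ?P] by simp
  show "{1..k} \<rightarrow>\<^sub>E X \<subseteq> ?P closure_of asymptotic_tuples G \<phi> X k"
  proof
    fix x
    assume x: "x \<in> {1..k} \<rightarrow>\<^sub>E X"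
    show "x \<in> ?P closure_of asymptotic_tuples G \<phi> X k"
      unfolding in_closure_of
    proof (intro conjI allI impI)
      show "x \<in> topspace ?P"
        using x by simp
      fix V
      assume "x \<in> V \<and> openin ?P V"
      then obtain W where W: "\<And>i. i \<in> {1..k} \<Longrightarrow> openin (top_of_set X) (W i)"
        "x \<in> PiE {1..k} W" "PiE {1..k} W \<subseteq> V"
        unfolding openin_product_topology_alt by metis
      have "\<exists>e>0. \<forall>y\<in>X. dist y (x i) < e \<longrightarrow> y \<in> W i" if "i \<in> {1..k}" for i
        using W(1)[OF that] W(2) that unfolding openin_euclidean_subtopology_iff by auto
      then obtain e where e: "\<And>i. i \<in> {1..k} \<Longrightarrow> e i > 0"
        "\<And>i y. i \<in> {1..k} \<Longrightarrow> y \<in> X \<Longrightarrow> dist y (x i) < e i \<Longrightarrow> y \<in> W i"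
        by metis
      define r where "r = Min (e ` {1..k})"
      have r: "r > 0" "\<And>i. i \<in> {1..k} \<Longrightarrow> r \<le> e i"
        using e(1) assms(4) by (auto simp: r_def)
      \<comment> \<open>The remaining \<open>r/2\<close> absorbs the approximation error; openness
        of the balls keeps the total strictly below \<open>r\<close>.\<close>
      define U where "U i = X \<inter> ball (x i) (r/2)" for i
      have "x \<in> IE_tuples G \<phi> X k"
        using assms(5) x by (simp add: UPE_def)
      moreover have "U i \<subseteq> X \<and> x i \<in> top_of_set X interior_of U i" if "i \<in> {1..k}" for i
      proof -
        have "openin (top_of_set X) (U i)"
          by (auto simp: U_def openin_open)
        then have "top_of_set X interior_of U i = U i"
          by (rule interior_of_openin)
        then show ?thesis
          using x that r(1) by (auto simp: U_def)
      qed
      ultimately have "independence_density G \<phi> X k U > 0"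
        unfolding IE_tuples_def by blast
      then obtain y where y: "y \<in> asymptotic_tuples G \<phi> X k"
        "\<And>i. i \<in> {1..k} \<Longrightarrow> \<exists>u\<in>U i. dist u (y i) \<le> r/2"
        using positive_independence_density_imp_asymptotic_tuple[OF assms(1-4), of U "r/2"] r(1)
        by auto
      have yX: "y \<in> {1..k} \<rightarrow>\<^sub>E X"
        by (rule asymptotic_tuples_mem[OF y(1)])
      have "y i \<in> W i" if i: "i \<in> {1..k}" for i
      proof -
        obtain u where u: "dist (x i) u < r/2" "dist u (y i) \<le> r/2"
          using y(2)[OF i] by (auto simp: U_def)
        then have "dist (y i) (x i) < r"
          using dist_triangle[of "x i" "y i" u] by (simp add: dist_commute)
        moreover have "y i \<in> X"
          using yX i by (rule PiE_mem)
        ultimately show ?thesis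
          using e(2)[OF i] r(2)[OF i] by (meson less_le_trans)
      qed
      \<comment> \<open>The box constrains only indices in \<open>{1..k}\<close>; off them
        \<open>y\<close> has the default value required by \<open>PiE\<close>.\<close>
      then have "y \<in> V"
        using W(3) PiE_arb[OF yX] by (blast intro: PiE_I)
      then show "\<exists>y. y \<in> asymptotic_tuples G \<phi> X k \<and> y \<in> V"
        using y(1) by blast
    qed
  qed
qed

end

theorem corollary6p10:
  fixes G :: "('g, 'b) monoid_scheme"
    and \<phi> :: "'g \<Rightarrow> 'x::metric_space \<Rightarrow> 'x"
    and X :: "'x set"
  assumes "group G"
    and "countable (carrier G)"
    and "infinite (carrier G)"
    and "amenable G"
    and "compact X"
    and "action_by_homeos G \<phi> X"
    and "expansive G \<phi> X"
    and "strong_topological_Markov G \<phi> X"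
  shows "(\<forall>F. left_Folner G F \<and> top_entropy \<phi> X F > 0 \<longrightarrow>
            (\<forall>k\<ge>2. \<exists>x\<in>asymptotic_tuples G \<phi> X k. inj_on x {1..k}))
       \<and> (\<forall>k\<ge>2. UPE G \<phi> X k \<longrightarrow> dense_in_power X k (asymptotic_tuples G \<phi> X k))"
proof -
  have "continuous_on X (\<phi> g)" if "g \<in> carrier G" for g
    using assms(6) that homeomorphic_imp_continuous_map[of "top_of_set X" "top_of_set X" "\<phi> g"]
    unfolding action_by_homeos_def by auto
  moreover have "group_action G X \<phi>"
    using assms(6) by (simp add: action_by_homeos_def)
  ultimately interpret compact_action G X \<phi>
    using assms(5) by (intro compact_action.intro compact_action_axioms.intro)
  \<comment> \<open>The UPE claim mentions no Folner sequence, so amenability supplies one; the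
    entropy claim works with the sequence along which entropy is positive.\<close>
  obtain F where "left_Folner G F"
    using assms(4) by (auto simp: amenable_def)
  then show ?thesis
    using positive_entropy_imp_distinct_asymptotic_tuple[OF assms(7,8,3)]
      UPE_imp_dense_asymptotic_tuples[OF assms(7,8)] by blast
qed

end
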